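(* Let $n \ge 1$ be an integer. The number of matrices in $GL_n(GF(2))$ of multiplicative order exactly $2^n-1$ is $$\left(\prod_{i=1}^{n-1}(2^n-2^i)\right)\cdot\frac{\Phi(2^n-1)}{n}.$$
   Context: $GF(2)$ is the field with two elements and $GL_n(GF(2))$ is the group of invertible $n\times n$ matrices over $GF(2)$ under multiplication. The order of a matrix is its order as an element of this group; $2^n-1$ is the maximum possible order. $\Phi$ is Euler's totient function. The empty product (case $n=1$) equals $1$. *)

theory Defs
  imports
    Complex_Main
    "HOL-Library.Z2"
    "HOL-Number_Theory.Totient"
    "HOL-Algebra.Multiplicative_Group"
    "Jordan_Normal_Form.Matrix"
begin

text \<open>The type \<^typ>\<open>bit\<close> is the field with two elements.\<close>

definition GL2 :: "nat \<Rightarrow> bit mat monoid" where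
  "GL2 n = units_of (ring_mat TYPE(bit) n ())"

lemma group_GL2: "group (GL2 n)"
proof -
  interpret ring "ring_mat TYPE(bit) n ()"
    by (rule ring_mat)
  show ?thesis
    unfolding GL2_def by (rule units_group)
qed

lemma GL2_carrier: "carrier (GL2 n) = {A \<in> carrier_mat n n. invertible_mat A}"
proof -
  have "invertible_mat A \<longleftrightarrow>
        (\<exists>B \<in> carrier_mat n n. B * A = 1\<^sub>m n \<and> A * B = 1\<^sub>m n)"
    if A: "A \<in> carrier_mat n n" for A :: "bit mat"
  proof
    assume "invertible_mat A"
    then obtain B where B: "A * B = 1\<^sub>m n" "B * A = 1\<^sub>m (dim_row B)"
      using A unfolding invertible_mat_def inverts_mat_def by auto
    have "dim_col B = n" using arg_cong[OF B(1), of dim_col] by simp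
    moreover have "dim_row B = n" using arg_cong[OF B(2), of dim_col] A by simp
    ultimately show "\<exists>B \<in> carrier_mat n n. B * A = 1\<^sub>m n \<and> A * B = 1\<^sub>m n"
      using B by auto
  next
    assume "\<exists>B \<in> carrier_mat n n. B * A = 1\<^sub>m n \<and> A * B = 1\<^sub>m n"
    then show "invertible_mat A"
      using A unfolding invertible_mat_def inverts_mat_def by auto
  qed
  then show ?thesis
    by (auto simp: GL2_def units_of_def Units_def ring_mat_def)
qed

end

theory Submission
  imports
    Defs
    "HOL-Algebra.Algebraic_Closure_Type"
    "Jordan_Normal_Form.Char_Poly"
begin

text \<open>Let \<open>N = 2 ^ n - 1\<close>. A matrix \<open>A\<close> of order \<open>N\<close> is determined by two independent choices. Vectors
are encoded as polynomials of degree less than \<open>n\<close>; put \<open>e = 1\<close>, the first unit vector. The list \<open>e, A e, \<dots>, A ^ (n - 1) e\<close> is a basis beginning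
with \<open>e\<close>, and the characteristic polynomial of \<open>A\<close> is primitive, which here means that it has
degree \<open>n\<close> and divides \<open>X ^ m - 1\<close> exactly when \<open>N\<close> divides \<open>m\<close>. Conversely, in the
coordinates of a given basis, multiplication by \<open>X\<close> modulo a given primitive polynomial is a matrix
of order \<open>N\<close> with these data (\<open>inj_on_krylov_char_poly\<close>, \<open>singer_mat_exists\<close>). Adding one
vector at a time gives \<open>(2 ^ n - 2) (2 ^ n - 4) \<dots> (2 ^ n - 2 ^ (n - 1))\<close> bases
(\<open>card_indep_lists\<close>), so it remains to see that there are \<open>\<phi>(N) / n\<close> primitive polynomials.

The key to both parts is a counting argument about ideals of \<open>GF(2)[X]\<close>
(\<open>degree_and_residues\<close>): if \<open>X\<close> has order \<open>N\<close> modulo an ideal, and the ideal contains a nonzero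
polynomial \<open>q\<close> of degree at most \<open>n\<close>, then the \<open>N\<close> powers of \<open>X\<close> already are all the nonzero
residues modulo \<open>q\<close>. So \<open>q\<close> has degree exactly \<open>n\<close>, generates the ideal and is primitive, and
every polynomial outside the ideal is congruent to a power of \<open>X\<close>. For the annihilator of a matrix
of order \<open>N\<close>, such a \<open>q\<close> is supplied by the Cayley--Hamilton theorem (\<open>cayley_hamilton_op\<close>).
For the polynomials that vanish at an element of order \<open>N\<close> in the algebraic closure of \<open>GF(2)\<close>, it is
found by comparing the number of polynomials with the size of the field of order \<open>2 ^ n\<close>. Hence the
\<open>\<phi>(N)\<close> elements of order \<open>N\<close> are partitioned into the root sets of the primitive polynomials,
each of which has \<open>n\<close> elements (\<open>card_primitive_polys\<close>).\<close>

section \<open>Polynomials of bounded degree\<close>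

text \<open>This set plays two roles: it is the set of residues modulo a polynomial of degree \<open>n\<close>, and,
through coefficient sequences, it serves as the coordinate space \<open>K\<^sup>n\<close> on which matrices act.
Using one set for both makes the isomorphism between \<open>K[X]/(p)\<close> and \<open>K\<^sup>n\<close>
given by a basis a map from this set to itself.\<close>

definition polys_below :: "nat \<Rightarrow> 'a :: zero poly set" where
  "polys_below n = {q. \<forall>i\<ge>n. coeff q i = 0}"

lemma polys_below_iff: "q \<in> polys_below n \<longleftrightarrow> q = 0 \<or> degree q < n"
  unfolding polys_below_def
  by (auto simp: coeff_eq_0) (metis leading_coeff_0_iff not_less)

lemma polys_below_0: "polys_below 0 = {0}"
  by (auto simp: polys_below_iff)

lemma polys_below_Suc:
  "polys_below (Suc n) = (\<lambda>(a, q). pCons a q) ` (UNIV \<times> polys_below n)"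
proof (intro equalityI subsetI)
  fix q assume q: "q \<in> polys_below (Suc n)"
  obtain a r where r: "q = pCons a r" by (cases q)
  have "r \<in> polys_below n"
    using q unfolding polys_below_def r by (auto simp: coeff_pCons split: nat.splits)
  then show "q \<in> (\<lambda>(a, q). pCons a q) ` (UNIV \<times> polys_below n)"
    using r by auto
qed (auto simp: polys_below_def coeff_pCons split: nat.splits)

lemma UNIV_bit: "(UNIV :: bit set) = {0, 1}"
  by (auto intro: bit.exhaust)

lemma finite_card_polys_below:
  "finite (polys_below n :: bit poly set) \<and> card (polys_below n :: bit poly set) = 2 ^ n"
proof (induction n)
  case (Suc n)
  have inj: "inj_on (\<lambda>(a :: bit, q). pCons a q) A" for A
    by (auto simp: inj_on_def)
  show ?case
    using Suc.IH by (simp add: polys_below_Suc card_image[OF inj] card_cartesian_product UNIV_bit)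
qed (simp add: polys_below_0)

lemmas finite_polys_below = finite_card_polys_below[THEN conjunct1]
  and card_polys_below = finite_card_polys_below[THEN conjunct2]

lemma polys_below_add: "q \<in> polys_below n \<Longrightarrow> r \<in> polys_below n \<Longrightarrow> q + r \<in> polys_below n"
  and polys_below_diff: "q \<in> polys_below n \<Longrightarrow> r \<in> polys_below n \<Longrightarrow> q - r \<in> polys_below n"
  and polys_below_zero: "0 \<in> polys_below n"
  and polys_below_smult: "q \<in> polys_below n \<Longrightarrow> smult c q \<in> polys_below n"
  for q r :: "'a :: field poly"
  by (auto simp: polys_below_def)

lemma mod_in_polys_below: "(q :: 'a :: field poly) \<noteq> 0 \<Longrightarrow> r mod q \<in> polys_below (degree q)"
  using degree_mod_less[of q r] by (auto simp: polys_below_iff)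

section \<open>Ideals modulo which X has order 2 ^ n - 1\<close>

lemma full_order_pos: "n \<ge> 1 \<Longrightarrow> 0 < 2 ^ n - (1 :: nat)"
  using one_less_power[of "2 :: nat" n] by simp

text \<open>The common structure behind matrices, polynomials and field elements of order \<open>2 ^ n - 1\<close>: the
polynomials that annihilate a matrix \<open>A\<close>, are divisible by \<open>p\<close>, or vanish at \<open>a\<close> form such an
ideal, and the order hypothesis says that the image of \<open>X\<close> in the quotient has order
\<open>2 ^ n - 1\<close>.\<close>

locale full_order_ideal =
  fixes n :: nat and I :: "bit poly set"
  assumes n_pos: "n \<ge> 1"
    and add: "q \<in> I \<Longrightarrow> r \<in> I \<Longrightarrow> q + r \<in> I"
    and mult: "q \<in> I \<Longrightarrow> r * q \<in> I"
    and proper: "1 \<notin> I"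
    and order: "monom 1 m - 1 \<in> I \<longleftrightarrow> (2 ^ n - 1) dvd m"
begin

lemma diff: "q \<in> I \<Longrightarrow> r \<in> I \<Longrightarrow> q - r \<in> I"
  using add[of q "(-1) * r"] mult[of r "-1"] by simp

lemma order_pos: "2 ^ n - 1 > (0 :: nat)"
  using full_order_pos[OF n_pos] .

lemma monom_order: "monom 1 (2 ^ n - 1) - 1 \<in> I"
  by (simp add: order)

lemma monom_not_in: "monom 1 k \<notin> I"
proof
  assume "monom 1 k \<in> I"
  \<comment> \<open>A multiple of \<open>X ^ k\<close> is a power of \<open>X ^ N\<close>, and that is 1 modulo \<open>I\<close>.\<close>
  from mult[OF this, of "monom 1 ((2 ^ n - 1) * k - k)"]
  have "monom 1 ((2 ^ n - 1) * k) \<in> I"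
    using order_pos by (cases "2 ^ n - 1 :: nat") (simp_all add: mult_monom add.commute)
  moreover have "monom 1 ((2 ^ n - 1) * k) - 1 \<in> I"
    by (simp add: order)
  ultimately have "monom 1 ((2 ^ n - 1) * k) - (monom 1 ((2 ^ n - 1) * k) - 1) \<in> I"
    by (rule diff)
  then show False using proper by simp
qed

lemma monom_diff_in_aux:
  assumes "monom 1 j - monom 1 k \<in> I" "j \<le> k" "k < 2 ^ n - 1"
  shows "j = k"
proof -
  let ?N = "2 ^ n - 1 :: nat"
  \<comment> \<open>Modulo \<open>I\<close> the power \<open>X ^ N\<close> is 1, so the factor \<open>X ^ (N - j)\<close> cancels \<open>X ^ j\<close>.\<close>
  have eq: "monom 1 (k - j) - (1 :: bit poly) = (monom 1 ?N - 1) -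
      (monom 1 (k - j) * (monom 1 ?N - 1) + monom 1 (?N - j) * (monom 1 j - monom 1 k))"
    using assms by (simp add: algebra_simps mult_monom)
  have "monom 1 (k - j) - 1 \<in> I"
    unfolding eq by (intro diff add mult monom_order assms)
  then have "?N dvd k - j"
    by (simp only: order)
  then show ?thesis
    using assms by (auto dest: dvd_imp_le)
qed

lemma monom_diff_in:
  assumes "monom 1 j - monom 1 k \<in> I" "j < 2 ^ n - 1" "k < 2 ^ n - 1"
  shows "j = k"
proof (cases "j \<le> k")
  case True
  then show ?thesis using monom_diff_in_aux assms by blast
next
  case False
  have "monom 1 k - monom 1 j \<in> I"
    using mult[OF assms(1), of "-1"] by simp
  then show ?thesis using monom_diff_in_aux[of k j] assms False by simp
qed

context
  fixes q :: "bit poly"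
  assumes q: "q \<in> I" "q \<noteq> 0" "degree q \<le> n"
begin

lemma dvd_in: "q dvd r \<Longrightarrow> r \<in> I"
  using mult[OF q(1)] by (metis dvdE mult.commute)

text \<open>A pigeonhole argument: the powers \<open>X ^ k\<close> with \<open>k < 2 ^ n - 1\<close> are distinct and nonzero modulo
\<open>I\<close>, hence modulo \<open>q\<close>, but there are only \<open>2 ^ degree q - 1\<close> nonzero residues modulo \<open>q\<close>.
So the degree is at least \<open>n\<close>, and when it is \<open>n\<close> the powers exhaust the nonzero residues.\<close>

lemma degree_and_residues:
  "degree q = n \<and> (\<lambda>k. monom 1 k mod q) ` {..<2 ^ n - 1} = polys_below n - {0}"
proof -
  let ?f = "\<lambda>k. monom (1 :: bit) k mod q" and ?N = "2 ^ n - 1 :: nat"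
  have inj: "inj_on ?f {..<?N}"
    by (rule inj_onI) (auto intro!: monom_diff_in dvd_in mod_eq_dvd_iff[THEN iffD1])
  have sub: "?f ` {..<?N} \<subseteq> polys_below (degree q) - {0}"
    using mod_in_polys_below[OF q(2)] monom_not_in dvd_in by (auto simp: mod_eq_0_iff_dvd)
  have card_diff: "card (polys_below d - {0 :: bit poly}) = 2 ^ d - 1" for d
    by (simp add: card_polys_below finite_polys_below polys_below_zero)
  have card_im: "card (?f ` {..<?N}) = ?N"
    by (simp only: card_image[OF inj] card_lessThan)
  have fin: "finite (polys_below (degree q) - {0 :: bit poly})"
    by (simp add: finite_polys_below)
  have "?N \<le> 2 ^ degree q - 1"
    using card_mono[OF fin sub] by (simp only: card_im card_diff)
  then have "(2 :: nat) ^ n \<le> 2 ^ degree q"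
    using order_pos by (simp add: le_diff_conv)
  then have d: "degree q = n"
    using q(3) by simp
  have "?f ` {..<?N} = polys_below (degree q) - {0}"
    by (rule card_subset_eq[OF fin sub]) (simp only: card_im card_diff d)
  then show ?thesis using d by simp
qed

lemma generator_degree: "degree q = n"
  using degree_and_residues by simp

text \<open>Since powers of \<open>X\<close> are units modulo \<open>I\<close>, the quotient is a field. This form of the statement
is what replaces irreducibility of \<open>q\<close> below.\<close>

lemma not_in_imp_power:
  assumes "r \<notin> I"
  shows "\<exists>k. q dvd r - monom 1 k"
proof -
  have "r mod q \<noteq> 0"
    using assms dvd_in by (auto simp: mod_eq_0_iff_dvd)
  then have "r mod q \<in> polys_below n - {0}"
    using mod_in_polys_below[OF q(2), of r] generator_degree by simp
  then obtain k where "r mod q = monom 1 k mod q"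
    using degree_and_residues by blast
  then show ?thesis by (auto simp: mod_eq_dvd_iff)
qed

lemma in_iff_dvd: "r \<in> I \<longleftrightarrow> q dvd r"
proof
  assume r: "r \<in> I"
  show "q dvd r"
  proof (rule ccontr)
    assume "\<not> q dvd r"
    then have "r mod q \<in> polys_below n - {0}"
      using mod_in_polys_below[OF q(2), of r] generator_degree by (simp add: mod_eq_0_iff_dvd)
    then obtain k where "r mod q = monom 1 k mod q"
      using degree_and_residues by blast
    then have "r - monom 1 k \<in> I"
      by (auto simp: mod_eq_dvd_iff intro: dvd_in)
    from diff[OF r this] show False
      using monom_not_in by simp
  qed
qed (rule dvd_in)

end

end

text \<open>For positive \<open>n\<close> these are the minimal polynomials of the generators of the multiplicative
group of the field of order \<open>2 ^ n\<close>. Over the field with two elements every nonzero polynomial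
is monic.\<close>

definition primitive_polys :: "nat \<Rightarrow> bit poly set" where
  "primitive_polys n = {p. degree p = n \<and> (\<forall>m. p dvd monom 1 m - 1 \<longleftrightarrow> (2 ^ n - 1) dvd m)}"

lemma (in full_order_ideal) generator_primitive:
  "q \<in> I \<Longrightarrow> q \<noteq> 0 \<Longrightarrow> degree q \<le> n \<Longrightarrow> q \<in> primitive_polys n"
  by (simp add: primitive_polys_def generator_degree order flip: in_iff_dvd)

lemma primitive_ideal:
  assumes "p \<in> primitive_polys n" "n \<ge> 1"
  shows "full_order_ideal n {q. p dvd q}"
proof
  show "1 \<notin> {q. p dvd q}"
    using assms by (auto simp: primitive_polys_def poly_dvd_1)
qed (use assms in \<open>auto simp: primitive_polys_def\<close>)

lemma finite_primitive_polys: "finite (primitive_polys n)"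
proof (rule finite_subset)
  show "primitive_polys n \<subseteq> polys_below (Suc n)"
    by (auto simp: primitive_polys_def polys_below_iff)
qed (rule finite_polys_below)

section \<open>Elements of order 2 ^ n - 1 in the algebraic closure\<close>

lemma CHAR_bit: "CHAR(bit) = 2"
proof (rule CHAR_eqI)
  fix m assume "of_nat m = (0 :: bit)"
  moreover have "of_nat m = (of_bool (odd m) :: bit)"
    by (induction m) auto
  ultimately show "2 dvd m" by simp
qed simp

interpretation to_ac: field_hom "to_ac :: bit \<Rightarrow> bit alg_closure"
  by unfold_locales (rule to_ac_0 to_ac_1 to_ac_add to_ac_mult)+

interpretation ac_poly: map_poly_inj_idom_hom "to_ac :: bit \<Rightarrow> bit alg_closure" ..

abbreviation eval_ac :: "bit alg_closure \<Rightarrow> bit poly \<Rightarrow> bit alg_closure" where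
  "eval_ac a q \<equiv> poly (map_poly to_ac q) a"

lemma eval_ac_simps [simp]:
  "eval_ac a (p + q) = eval_ac a p + eval_ac a q" "eval_ac a (p - q) = eval_ac a p - eval_ac a q"
  "eval_ac a (p * q) = eval_ac a p * eval_ac a q" "eval_ac a (monom 1 k) = a ^ k"
  "eval_ac a 1 = 1" "eval_ac a 0 = 0"
  by (simp_all add: hom_distribs poly_monom)

text \<open>Without a root shared with its derivative, a polynomial has no multiple roots, so splitting off
one linear factor after the other never repeats a root.\<close>

lemma card_roots_separable:
  fixes p :: "'a :: alg_closed_field poly"
  assumes "p \<noteq> 0" "\<And>a. poly p a = 0 \<Longrightarrow> poly (pderiv p) a \<noteq> 0"
  shows "card {a. poly p a = 0} = degree p"
  using assms
proof (induction "degree p" arbitrary: p)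
  case 0
  then obtain c where "p = [:c:]" by (metis degree_eq_zeroE)
  then show ?case using 0 by simp
next
  case (Suc d)
  then obtain a where a: "poly p a = 0"
    using alg_closed_imp_poly_has_root[of p] by auto
  then obtain q where q: "p = [:-a, 1:] * q"
    by (auto simp: poly_eq_0_iff_dvd elim: dvdE)
  have q0: "q \<noteq> 0" using Suc.prems q by auto
  have deg: "degree p = Suc (degree q)"
    unfolding q using q0 by (subst degree_mult_eq) auto
  have der: "pderiv p = [:-a, 1:] * pderiv q + q"
    unfolding q pderiv_mult by (simp add: pderiv_pCons)
  have qa: "poly q a \<noteq> 0"
    using Suc.prems(2)[OF a] by (simp add: der)
  have "card {b. poly q b = 0} = degree q"
  proof (rule Suc.hyps(1))
    fix b assume b: "poly q b = 0"
    then have "poly p b = 0" by (simp add: q)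
    from Suc.prems(2)[OF this] show "poly (pderiv q) b \<noteq> 0"
      using b by (auto simp: der)
  qed (use deg Suc.hyps q0 in auto)
  moreover have "{b. poly p b = 0} = insert a {b. poly q b = 0}"
    unfolding q by auto
  ultimately show ?case
    using qa poly_roots_finite[OF q0] deg by simp
qed

text \<open>A divisor of \<open>X ^ m - 1\<close> inherits separability: a common root of \<open>p\<close> and its derivative
would be a common root of \<open>X ^ m - 1\<close> and \<open>m X ^ (m - 1)\<close>.\<close>

lemma card_roots_dvd_unity:
  fixes p :: "'a :: alg_closed_field poly"
  assumes dvd: "p dvd monom 1 m - 1" and m: "of_nat m \<noteq> (0 :: 'a)"
  shows "card {a. poly p a = 0} = degree p"
proof (rule card_roots_separable)
  have m0: "m \<noteq> 0" using m by (metis of_nat_0)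
  from dvd obtain q where q: "monom 1 m - 1 = p * q" by (elim dvdE)
  have "monom 1 m - 1 \<noteq> (0 :: 'a poly)"
    using m0 by (auto simp: poly_eq_iff dest!: spec[of _ m])
  then show "p \<noteq> 0" using q by auto
  fix a assume a: "poly p a = 0"
  have "poly (monom 1 m - 1) a = 0" by (simp add: q a)
  then have am: "a ^ m = 1" by (simp add: poly_monom)
  then have "a \<noteq> 0" using m0 by (auto simp: power_0_left)
  then have "poly (pderiv (monom 1 m - 1)) a \<noteq> 0"
    using m by (simp add: pderiv_diff pderiv_monom poly_monom)
  then show "poly (pderiv p) a \<noteq> 0"
    unfolding q by (auto simp: pderiv_mult a)
qed

lemma of_nat_order_nonzero:
  assumes "n \<ge> 1"
  shows "of_nat (2 ^ n - 1) \<noteq> (0 :: bit alg_closure)"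
proof -
  have "odd (2 ^ n - 1 :: nat)" using assms by simp
  then show ?thesis
    by (simp add: of_nat_eq_0_iff_char_dvd CHAR_bit del: of_nat_diff)
qed

text \<open>The fixed points of the \<open>n\<close>-th power of Frobenius: the field of order \<open>2 ^ n\<close>.\<close>

definition subfield_ac :: "nat \<Rightarrow> bit alg_closure set" where
  "subfield_ac n = {a. a ^ 2 ^ n = a}"

text \<open>Besides giving the number of elements, this description shows that every element of order
\<open>2 ^ n - 1\<close> lies in the subfield.\<close>

lemma subfield_ac_eq: "n \<ge> 1 \<Longrightarrow> subfield_ac n = insert 0 {a. a ^ (2 ^ n - 1) = 1}"
proof -
  assume n: "n \<ge> 1"
  have eq: "a ^ 2 ^ n = a * a ^ (2 ^ n - 1)" for a :: "bit alg_closure"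
    by (simp flip: power_Suc)
  show ?thesis using n by (auto simp: subfield_ac_def eq)
qed

lemma card_roots_of_unity:
  assumes "n \<ge> 1"
  shows "card {a :: bit alg_closure. a ^ (2 ^ n - 1) = 1} = 2 ^ n - 1"
proof -
  let ?N = "2 ^ n - 1 :: nat"
  have N: "?N > 0" using full_order_pos[OF assms] .
  have deg: "degree (monom 1 ?N - 1 :: bit alg_closure poly) = ?N"
    using N degree_add_eq_left[of "- 1" "monom 1 ?N :: bit alg_closure poly"]
    by (simp add: degree_monom_eq)
  have "card {a :: bit alg_closure. poly (monom 1 ?N - 1) a = 0} = ?N"
    using card_roots_dvd_unity[OF dvd_refl of_nat_order_nonzero[OF assms]] deg by simp
  then show ?thesis by (simp add: poly_monom)
qed

lemma card_subfield_ac: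
  assumes "n \<ge> 1"
  shows "finite (subfield_ac n) \<and> card (subfield_ac n) = 2 ^ n"
proof -
  have N: "2 ^ n - 1 > (0 :: nat)" using full_order_pos[OF assms] .
  have fin: "finite {a :: bit alg_closure. a ^ (2 ^ n - 1) = 1}"
    using card_roots_of_unity[OF assms] N by (auto intro: card_ge_0_finite)
  have notin: "0 \<notin> {a :: bit alg_closure. a ^ (2 ^ n - 1) = 1}"
    using N by (simp add: power_0_left)
  have "card (subfield_ac n) = Suc (2 ^ n - 1)"
    by (simp only: subfield_ac_eq[OF assms] card_insert_disjoint[OF fin notin]
        card_roots_of_unity[OF assms])
  then show ?thesis
    using N fin by (simp add: subfield_ac_eq[OF assms])
qed

lemma subfield_ac_0: "0 \<in> subfield_ac n" and subfield_ac_1: "1 \<in> subfield_ac n"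
  by (simp_all add: subfield_ac_def power_0_left)

lemma subfield_ac_mult: "a \<in> subfield_ac n \<Longrightarrow> b \<in> subfield_ac n \<Longrightarrow> a * b \<in> subfield_ac n"
  and subfield_ac_inverse: "a \<in> subfield_ac n \<Longrightarrow> inverse a \<in> subfield_ac n"
  by (simp_all add: subfield_ac_def power_mult_distrib power_inverse)

lemma CHAR_ac: "CHAR(bit alg_closure) = 2"
  by (simp add: CHAR_bit)

lemma subfield_ac_add:
  assumes "a \<in> subfield_ac n" "b \<in> subfield_ac n"
  shows "a + b \<in> subfield_ac n"
proof -
  have "(a + b) ^ 2 ^ n = a ^ 2 ^ n + b ^ 2 ^ n"
    by (rule freshmans_dream') (simp_all only: CHAR_ac two_is_prime_nat)
  then show ?thesis using assms by (simp add: subfield_ac_def)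
qed

lemma add_self_ac: "a + a = (0 :: bit alg_closure)"
proof -
  have "(of_nat 2 :: bit alg_closure) = 0"
    using of_nat_CHAR[where 'a = "bit alg_closure"] unfolding CHAR_ac .
  then show ?thesis by (metis mult_2 mult_zero_left of_nat_numeral)
qed

lemmas subfield_ac_closed = subfield_ac_0 subfield_ac_1 subfield_ac_mult subfield_ac_inverse
  subfield_ac_add

text \<open>The subfield as a ring record, in order to apply the theorem that the multiplicative group of a
finite field is cyclic.\<close>

definition subfield_ring :: "nat \<Rightarrow> bit alg_closure ring" where
  "subfield_ring n = \<lparr>carrier = subfield_ac n, mult = (*), one = 1, zero = 0, add = (+)\<rparr>"

lemma field_subfield_ring: "Ring.field (subfield_ring n)"
proof (rule cring.cring_fieldI2)
  show "cring (subfield_ring n)"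
  proof (rule cringI)
    show "abelian_group (subfield_ring n)"
    proof (rule abelian_groupI)
      \<comment> \<open>In characteristic 2 every element is its own negative.\<close>
      fix x assume "x \<in> carrier (subfield_ring n)"
      then show "\<exists>y\<in>carrier (subfield_ring n). y \<oplus>\<^bsub>subfield_ring n\<^esub> x = \<zero>\<^bsub>subfield_ring n\<^esub>"
        by (intro bexI[of _ x]) (auto simp: subfield_ring_def subfield_ac_closed add_self_ac)
    qed (auto simp: subfield_ring_def subfield_ac_closed algebra_simps)
    show "Group.comm_monoid (subfield_ring n)"
      by (rule comm_monoidI) (auto simp: subfield_ring_def subfield_ac_closed algebra_simps)
  qed (auto simp: subfield_ring_def algebra_simps)
next
  fix a assume "a \<in> carrier (subfield_ring n)" "a \<noteq> \<zero>\<^bsub>subfield_ring n\<^esub>"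
  then show "\<exists>b\<in>carrier (subfield_ring n). a \<otimes>\<^bsub>subfield_ring n\<^esub> b = \<one>\<^bsub>subfield_ring n\<^esub>"
    by (intro bexI[of _ "inverse a"]) (auto simp: subfield_ring_def subfield_ac_closed)
qed (simp add: subfield_ring_def)

definition full_order_elems :: "nat \<Rightarrow> bit alg_closure set" where
  "full_order_elems n = {a. \<forall>m. a ^ m = 1 \<longleftrightarrow> (2 ^ n - 1) dvd m}"

text \<open>The multiplicative group of the field of order \<open>2 ^ n\<close> is cyclic of order \<open>2 ^ n - 1\<close>, and a
cyclic group of order \<open>N\<close> has \<open>totient N\<close> generators.\<close>

lemma card_full_order_elems:
  assumes n: "n \<ge> 1"
  shows "card (full_order_elems n) = totient (2 ^ n - 1)"
proof -
  let ?R = "subfield_ring n" and ?M = "Multiplicative_Group.mult_of (subfield_ring n)"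
    and ?N = "2 ^ n - 1 :: nat"
  interpret F: Ring.field ?R by (rule field_subfield_ring)
  interpret M: Group.group ?M by (rule F.field_mult_group)
  have fin: "finite (carrier ?R)"
    using card_subfield_ac[OF n] by (simp add: subfield_ring_def)
  have ord: "Coset.order (?M) = ?N"
    using F.order_mult_of[OF fin] card_subfield_ac[OF n]
    by (simp add: subfield_ring_def Coset.order_def)
  have pow: "a [^]\<^bsub>?M\<^esub> (k :: nat) = a ^ k" for a k
    by (induction k) (simp_all add: nat_pow_def subfield_ring_def mult.commute)
  obtain g where g: "g \<in> carrier (?M)"
      "carrier (?M) = {g [^]\<^bsub>?R\<^esub> i | i :: nat. i \<in> UNIV}"
    using F.finite_field_mult_group_has_gen[OF fin] by blast
  have "M.ord g = ?N"
  proof -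
    have "carrier (?M) = range (\<lambda>i :: nat. g [^]\<^bsub>?M\<^esub> i)"
      unfolding g(2) Multiplicative_Group.nat_pow_mult_of by auto
    also have "\<dots> = generate (?M) {g}"
      using M.generate_pow_on_finite_carrier[OF F.finite_mult_of[OF fin] g(1)] by auto
    finally show ?thesis
      using M.generate_pow_card[OF g(1)] ord by (simp add: Coset.order_def)
  qed
  then have "card {a \<in> carrier (?M). M.ord a = ?N} = phi' ?N"
    using g(1) by (intro F.num_elems_of_ord_eq_phi'[OF fin]) (auto simp: ord)
  moreover have "phi' ?N = totient ?N"
    unfolding phi'_def totient_def totatives_def
    by (rule arg_cong[of _ _ card]) auto
  moreover have "{a \<in> carrier (?M). M.ord a = ?N} = full_order_elems n"
    (is "?L = _")
  proof (intro equalityI subsetI)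
    fix a assume "a \<in> ?L"
    then have a: "a \<in> carrier (?M)" "M.ord a = ?N" by auto
    have "a ^ m = 1 \<longleftrightarrow> ?N dvd m" for m
      using M.pow_eq_id[OF a(1), of m] unfolding a(2) pow
      by (simp add: subfield_ring_def)
    then show "a \<in> full_order_elems n" by (simp add: full_order_elems_def)
  next
    fix a assume "a \<in> full_order_elems n"
    then have a: "a ^ m = 1 \<longleftrightarrow> ?N dvd m" for m
      by (simp only: full_order_elems_def mem_Collect_eq)
    have "a ^ ?N = 1" by (simp only: a dvd_refl)
    moreover from this have "a \<noteq> 0"
      using full_order_pos[OF n] by (auto simp: power_0_left)
    ultimately have car: "a \<in> carrier (?M)"
      using n by (simp add: subfield_ring_def subfield_ac_eq)
    have "M.ord a dvd m \<longleftrightarrow> ?N dvd m" for m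
      using M.pow_eq_id[OF car, of m] a[of m] unfolding pow
      by (simp add: subfield_ring_def)
    then have "M.ord a = ?N" by (meson dvd_antisym dvd_refl)
    then show "a \<in> ?L" using car by simp
  qed
  ultimately show ?thesis by simp
qed


section \<open>Counting primitive polynomials by their roots\<close>

lemma dvd_same_degree_eq:
  assumes "p dvd q" "degree p = degree q" "q \<noteq> (0 :: bit poly)"
  shows "p = q"
proof -
  obtain k where k: "q = p * k" using assms(1) by (elim dvdE)
  then have "k \<noteq> 0" "p \<noteq> 0" using assms(3) by auto
  then have "degree k = 0" using k assms(2) by (simp add: degree_mult_eq)
  then obtain c where "k = [:c:]" by (elim degree_eq_zeroE)
  moreover from this \<open>k \<noteq> 0\<close> have "c = 1" by auto
  ultimately show ?thesis using k by simp
qed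

lemma eval_ac_dvd: "eval_ac a p = 0 \<Longrightarrow> p dvd q \<Longrightarrow> eval_ac a q = 0"
  by (metis dvdE eval_ac_simps(3) mult_zero_left)

lemma eval_ac_in_subfield_ac:
  assumes "a \<in> subfield_ac n"
  shows "eval_ac a q \<in> subfield_ac n"
proof (induction q)
  case (pCons c q)
  have "to_ac c \<in> subfield_ac n" by (cases c) (simp_all add: subfield_ac_closed)
  then show ?case using pCons assms by (simp add: map_poly_pCons subfield_ac_closed)
qed (simp add: subfield_ac_closed)

context
  fixes n :: nat
  assumes n: "n \<ge> 1"
begin

lemma full_order_elems_nonzero:
  assumes "a \<in> full_order_elems n"
  shows "a ^ k \<noteq> 0"
proof -
  have "a ^ (2 ^ n - 1) = 1"
    using assms by (simp only: full_order_elems_def mem_Collect_eq dvd_refl)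
  then have "a \<noteq> 0"
    using full_order_pos[OF n] by (metis power_0_left zero_neq_one less_irrefl)
  then show ?thesis by simp
qed

text \<open>If \<open>p\<close> does not divide \<open>X ^ m - 1\<close>, then \<open>X ^ m - 1\<close> is congruent to a power of \<open>X\<close> modulo
\<open>p\<close>, so \<open>a ^ m - 1\<close> is a power of \<open>a\<close> and therefore nonzero.\<close>

lemma primitive_roots_full_order:
  assumes p: "p \<in> primitive_polys n" and a: "eval_ac a p = 0"
  shows "a \<in> full_order_elems n"
proof -
  interpret full_order_ideal n "{q. p dvd q}"
    by (rule primitive_ideal[OF p n])
  have deg: "p \<noteq> 0" "degree p \<le> n" using p n by (auto simp: primitive_polys_def)
  note vanish = eval_ac_dvd[OF a]
  have "eval_ac a (monom 1 (2 ^ n - 1) - 1) = 0"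
    by (rule vanish) (use monom_order in simp)
  then have "a ^ (2 ^ n - 1) = 1" by (simp add: poly_monom)
  then have a0: "a \<noteq> 0"
    using full_order_pos[OF n] by (metis power_0_left zero_neq_one less_irrefl)
  have "a ^ m = 1 \<longleftrightarrow> p dvd monom 1 m - 1" for m
  proof
    assume am: "a ^ m = 1"
    show "p dvd monom 1 m - 1"
    proof (rule ccontr)
      assume "\<not> ?thesis"
      then obtain k where "p dvd monom 1 m - 1 - monom 1 k"
        using not_in_imp_power[of p "monom 1 m - 1"] deg by auto
      from vanish[OF this] show False using am a0 by (simp add: poly_monom)
    qed
  next
    assume "p dvd monom 1 m - 1"
    from vanish[OF this] show "a ^ m = 1" by (simp add: poly_monom)
  qed
  then show ?thesis using p by (simp add: full_order_elems_def primitive_polys_def)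
qed

text \<open>If \<open>p\<close> did not divide \<open>q\<close>, then \<open>q\<close> would be congruent to a power of \<open>X\<close> modulo \<open>p\<close>,
and \<open>0 = q(a)\<close> would be a power of \<open>a\<close>.\<close>

lemma primitive_root_unique:
  assumes p: "p \<in> primitive_polys n" and q: "q \<in> primitive_polys n"
    and a: "eval_ac a p = 0" "eval_ac a q = 0"
  shows "p = q"
proof -
  interpret full_order_ideal n "{q. p dvd q}"
    by (rule primitive_ideal[OF p n])
  have deg: "p \<noteq> 0" "degree p = n" "q \<noteq> 0" "degree q = n"
    using p q n by (auto simp: primitive_polys_def)
  have "p dvd q"
  proof (rule ccontr)
    assume "\<not> p dvd q"
    then obtain k where "p dvd q - monom 1 k"
      using not_in_imp_power[of p q] deg by auto
    from eval_ac_dvd[OF a(1) this] have "a ^ k = 0" using a by (simp add: poly_monom)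
    then show False
      using full_order_elems_nonzero primitive_roots_full_order[OF p a(1)] by blast
  qed
  then show ?thesis using deg by (intro dvd_same_degree_eq) auto
qed

text \<open>The \<open>2 ^ (n + 1)\<close> polynomials of degree at most \<open>n\<close> take values at \<open>a\<close> in a field with
\<open>2 ^ n\<close> elements, so two of them agree at \<open>a\<close>; their difference lies in the vanishing ideal
of \<open>a\<close> and has degree at most \<open>n\<close>, which makes it primitive.\<close>

lemma full_order_root_exists:
  assumes a: "a \<in> full_order_elems n"
  shows "\<exists>p\<in>primitive_polys n. eval_ac a p = 0"
proof -
  have ord_a: "a ^ m = 1 \<longleftrightarrow> (2 ^ n - 1) dvd m" for m
    using a by (simp only: full_order_elems_def mem_Collect_eq)
  interpret full_order_ideal n "{q. eval_ac a q = 0}"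
    by unfold_locales (use n ord_a in \<open>simp_all add: poly_monom\<close>)
  have "a \<in> subfield_ac n"
    using ord_a[of "2 ^ n - 1"] by (simp add: subfield_ac_eq[OF n])
  then have "eval_ac a ` polys_below (Suc n) \<subseteq> subfield_ac n"
    using eval_ac_in_subfield_ac by auto
  then have "card (eval_ac a ` polys_below (Suc n)) \<le> 2 ^ n"
    using card_mono card_subfield_ac[OF n] by metis
  then have "card (eval_ac a ` polys_below (Suc n)) < card (polys_below (Suc n) :: bit poly set)"
    unfolding card_polys_below by (rule le_less_trans) simp
  then have "\<not> inj_on (eval_ac a) (polys_below (Suc n))"
    by (rule pigeonhole)
  then obtain q r where qr: "q \<in> polys_below (Suc n)" "r \<in> polys_below (Suc n)"
      "eval_ac a q = eval_ac a r" "q \<noteq> r"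
    by (auto simp: inj_on_def)
  have below: "q - r \<in> polys_below (Suc n)" and ne: "q - r \<noteq> 0"
    using qr by (auto intro: polys_below_diff)
  then have deg: "degree (q - r) \<le> n"
    by (simp add: polys_below_iff)
  have "q - r \<in> primitive_polys n"
    using qr(3) by (intro generator_primitive ne deg) simp
  moreover have "eval_ac a (q - r) = 0" using qr(3) by simp
  ultimately show ?thesis by blast
qed

lemma card_primitive_roots:
  assumes p: "p \<in> primitive_polys n"
  shows "card {a. eval_ac a p = 0} = n"
proof -
  have "p dvd monom 1 (2 ^ n - 1) - 1"
    using p by (simp add: primitive_polys_def)
  then obtain q where "monom 1 (2 ^ n - 1) - 1 = p * q" by (elim dvdE)
  then have "map_poly to_ac (monom 1 (2 ^ n - 1) - 1) = map_poly to_ac p * map_poly to_ac q"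
    by (simp only: ac_poly.hom_mult)
  then have "map_poly to_ac p dvd monom 1 (2 ^ n - 1) - 1"
    by (simp add: hom_distribs)
  from card_roots_dvd_unity[OF this of_nat_order_nonzero[OF n]]
  show ?thesis using p by (simp add: primitive_polys_def)
qed

text \<open>Each primitive polynomial has \<open>n\<close> distinct roots, and the root sets of the primitive
polynomials partition the elements of order \<open>2 ^ n - 1\<close>.\<close>

lemma card_primitive_polys: "n * card (primitive_polys n) = totient (2 ^ n - 1)"
proof -
  have "full_order_elems n = (\<Union>p\<in>primitive_polys n. {a. eval_ac a p = 0})"
    using full_order_root_exists primitive_roots_full_order by auto
  also have "card \<dots> = (\<Sum>p\<in>primitive_polys n. card {a. eval_ac a p = 0})"
  proof (rule card_UN_disjoint)
    show "\<forall>p\<in>primitive_polys n. finite {a. eval_ac a p = 0}"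
      using card_primitive_roots n by (metis card.infinite not_one_le_zero)
  qed (use finite_primitive_polys primitive_root_unique in auto)
  also have "\<dots> = n * card (primitive_polys n)"
    by (simp add: card_primitive_roots)
  finally show ?thesis using card_full_order_elems[OF n] by simp
qed

end

section \<open>The action of polynomials through a linear operator\<close>

text \<open>The value of \<open>q(T)\<close> at \<open>v\<close>, evaluated by the Horner scheme.\<close>

definition poly_act :: "('a :: field poly \<Rightarrow> 'a poly) \<Rightarrow> 'a poly \<Rightarrow> 'a poly \<Rightarrow> 'a poly" where
  "poly_act T q v = fold_coeffs (\<lambda>a w. smult a v + T w) q 0"

locale linear_op =
  fixes T :: "'a :: field poly \<Rightarrow> 'a poly"
  assumes T_add: "T (v + w) = T v + T w"
    and T_smult: "T (smult c v) = smult c (T v)"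
begin

lemma T_0 [simp]: "T 0 = 0"
  using T_smult[of 0 0] by simp

lemma funpow_0 [simp]: "(T ^^ k) 0 = 0"
  by (induction k) auto

lemma poly_act_0 [simp]: "poly_act T 0 v = 0"
  by (simp add: poly_act_def)

lemma poly_act_pCons [simp]: "poly_act T (pCons a q) v = smult a v + T (poly_act T q v)"
  by (cases "a = 0 \<and> q = 0") (auto simp: poly_act_def fold_coeffs_pCons_not_0_0_eq)

lemma poly_act_1 [simp]: "poly_act T 1 v = v"
  by (simp add: one_pCons)

lemma poly_act_add: "poly_act T (p + q) v = poly_act T p v + poly_act T q v"
proof (induction p arbitrary: q)
  case (pCons a p)
  obtain b r where "q = pCons b r" by (cases q)
  then show ?case
    by (simp add: pCons.IH smult_add_left T_add algebra_simps)
qed simp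

lemma poly_act_smult: "poly_act T (smult c q) v = smult c (poly_act T q v)"
  by (induction q) (simp_all add: T_smult smult_add_right)

lemma poly_act_diff: "poly_act T (p - q) v = poly_act T p v - poly_act T q v"
  using poly_act_add[of "p - q" q v] by (simp add: eq_diff_eq)

lemma poly_act_mult: "poly_act T (p * q) v = poly_act T p (poly_act T q v)"
  by (induction p) (simp_all add: mult_pCons_left poly_act_add poly_act_smult)

lemma poly_act_vec_0 [simp]: "poly_act T q 0 = 0"
  by (induction q) auto

lemma poly_act_vec_add: "poly_act T q (v + w) = poly_act T q v + poly_act T q w"
  by (induction q) (simp_all add: smult_add_right T_add algebra_simps)

lemma poly_act_sum: "poly_act T (\<Sum>i\<in>A. f i) v = (\<Sum>i\<in>A. poly_act T (f i) v)"
  by (induction A rule: infinite_finite_induct) (simp_all add: poly_act_add)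

lemma poly_act_vec_sum: "poly_act T q (\<Sum>i\<in>A. f i) = (\<Sum>i\<in>A. poly_act T q (f i))"
  by (induction A rule: infinite_finite_induct) (simp_all add: poly_act_vec_add)

lemma poly_act_vec_smult: "poly_act T q (smult c v) = smult c (poly_act T q v)"
  by (induction q) (simp_all add: T_smult smult_add_right mult.commute)

lemma poly_act_monom: "poly_act T (monom 1 k) v = (T ^^ k) v"
  by (induction k) (simp_all add: monom_Suc flip: one_pCons)

lemma poly_act_dvd: "poly_act T p v = 0 \<Longrightarrow> p dvd q \<Longrightarrow> poly_act T q v = 0"
  by (metis dvdE mult.commute poly_act_mult poly_act_vec_0)

lemma poly_act_mod:
  assumes "poly_act T p v = 0"
  shows "poly_act T (q mod p) v = poly_act T q v"
proof -
  have "p dvd q - q mod p" by (simp add: minus_mod_eq_mult_div)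
  from poly_act_dvd[OF assms this] show ?thesis by (simp add: poly_act_diff)
qed

end

lemma polys_below_expand:
  assumes "(q :: 'a :: field poly) \<in> polys_below n"
  shows "q = (\<Sum>i<n. smult (coeff q i) (monom 1 i))"
  using assms by (auto simp: poly_eq_iff coeff_sum polys_below_def if_distrib cong: if_cong)

lemma (in linear_op) poly_act_below:
  assumes "q \<in> polys_below n"
  shows "poly_act T q v = (\<Sum>i<n. smult (coeff q i) ((T ^^ i) v))"
  by (subst polys_below_expand[OF assms])
    (simp only: poly_act_sum poly_act_smult poly_act_monom)

section \<open>Matrices as operators on polynomials of bounded degree\<close>

text \<open>Multiplication of the coefficient vector of \<open>v\<close> by \<open>A\<close>. Coefficients of \<open>v\<close> beyond the number
of columns are cut off, which makes the operator linear on all polynomials.\<close>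

definition mat_op :: "'a :: field mat \<Rightarrow> 'a poly \<Rightarrow> 'a poly" where
  "mat_op A v = (\<Sum>i<dim_row A. monom (\<Sum>j<dim_col A. A $$ (i, j) * coeff v j) i)"

lemma coeff_mat_op:
  assumes "A \<in> carrier_mat n n"
  shows "coeff (mat_op A v) i = (if i < n then \<Sum>j<n. A $$ (i, j) * coeff v j else 0)"
  using assms by (auto simp: mat_op_def coeff_sum)

lemma mat_op_closed: "A \<in> carrier_mat n n \<Longrightarrow> mat_op A v \<in> polys_below n"
  by (auto simp: polys_below_def coeff_mat_op)

lemma linear_mat_op: "linear_op (mat_op A)"
  by unfold_locales
    (simp_all add: mat_op_def poly_eq_iff coeff_sum algebra_simps sum.distrib sum_distrib_left)

lemma mat_op_mult:
  assumes A: "A \<in> carrier_mat n n" and B: "B \<in> carrier_mat n n"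
  shows "mat_op (A * B) v = mat_op A (mat_op B v)"
proof (rule poly_eqI)
  fix i
  have "(\<Sum>j<n. (\<Sum>k<n. A $$ (i, k) * B $$ (k, j)) * coeff v j) =
      (\<Sum>k<n. A $$ (i, k) * (\<Sum>j<n. B $$ (k, j) * coeff v j))"
    by (simp add: sum_distrib_left sum_distrib_right mult.assoc) (rule sum.swap)
  moreover have "(A * B) $$ (i, j) = (\<Sum>k<n. A $$ (i, k) * B $$ (k, j))" if "i < n" "j < n" for j
    using A B that by (simp add: scalar_prod_def atLeast0LessThan)
  ultimately show "coeff (mat_op (A * B) v) i = coeff (mat_op A (mat_op B v)) i"
    by (simp add: coeff_mat_op[OF A] coeff_mat_op[OF B] coeff_mat_op[OF mult_carrier_mat[OF A B]])
qed

lemma mat_op_one: "v \<in> polys_below n \<Longrightarrow> mat_op (1\<^sub>m n) v = v"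
proof (rule poly_eqI)
  fix i assume "v \<in> polys_below n"
  then show "coeff (mat_op (1\<^sub>m n) v) i = coeff v i"
    by (auto simp: coeff_mat_op[OF one_carrier_mat] polys_below_def if_distrib if_distribR
        cong: if_cong)
qed

lemma mat_op_monom:
  assumes "A \<in> carrier_mat n n" "j < n"
  shows "coeff (mat_op A (monom 1 j)) i = (if i < n then A $$ (i, j) else 0)"
  using assms by (auto simp: coeff_mat_op if_distrib cong: if_cong)

lemma monom_in_polys_below: "j < n \<Longrightarrow> monom c j \<in> polys_below n"
  by (auto simp: polys_below_def)

lemma mat_op_inject:
  assumes A: "A \<in> carrier_mat n n" and B: "B \<in> carrier_mat n n"
    and eq: "\<And>v. v \<in> polys_below n \<Longrightarrow> mat_op A v = mat_op B v"
  shows "A = B"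
proof (rule eq_matI)
  fix i j assume "i < dim_row B" "j < dim_col B"
  then have "i < n" "j < n" using B by auto
  then show "A $$ (i, j) = B $$ (i, j)"
    using arg_cong[OF eq[OF monom_in_polys_below[of j n 1]], of "\<lambda>v. coeff v i"]
    by (simp add: mat_op_monom[OF A] mat_op_monom[OF B])
qed (use A B in auto)

lemma mat_op_pow:
  assumes A: "A \<in> carrier_mat n n" and v: "v \<in> polys_below n"
  shows "mat_op (A ^\<^sub>m k) v = (mat_op A ^^ k) v"
  using v
proof (induction k arbitrary: v)
  case 0
  then show ?case using A by (simp add: mat_op_one)
next
  case (Suc k)
  then show ?case
    by (simp add: mat_op_mult[OF pow_carrier_mat[OF A] A] mat_op_closed[OF A]
        funpow_Suc_right del: funpow.simps)
qed

lemma mat_pow_eq_one_iff: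
  assumes A: "A \<in> carrier_mat n n"
  shows "A ^\<^sub>m k = 1\<^sub>m n \<longleftrightarrow> (\<forall>v\<in>polys_below n. (mat_op A ^^ k) v = v)"
proof
  assume "A ^\<^sub>m k = 1\<^sub>m n"
  then show "\<forall>v\<in>polys_below n. (mat_op A ^^ k) v = v"
    using mat_op_pow[OF A] mat_op_one by metis
next
  assume "\<forall>v\<in>polys_below n. (mat_op A ^^ k) v = v"
  then show "A ^\<^sub>m k = 1\<^sub>m n"
    using A by (intro mat_op_inject[of _ n]) (auto simp: mat_op_pow[OF A] mat_op_one)
qed

lemma mat_op_exists:
  fixes T :: "'a :: field poly \<Rightarrow> 'a poly"
  assumes closed: "\<And>v. v \<in> polys_below n \<Longrightarrow> T v \<in> polys_below n"
    and add: "\<And>v w. v \<in> polys_below n \<Longrightarrow> w \<in> polys_below n \<Longrightarrow> T (v + w) = T v + T w"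
    and smult: "\<And>c v. v \<in> polys_below n \<Longrightarrow> T (smult c v) = smult c (T v)"
  shows "\<exists>A\<in>carrier_mat n n. \<forall>v\<in>polys_below n. mat_op A v = T v"
proof
  define A where "A = mat n n (\<lambda>(i, j). coeff (T (monom 1 j)) i)"
  show A: "A \<in> carrier_mat n n" by (simp add: A_def)
  have T0: "T 0 = 0" using smult[of 0 0] by (simp add: polys_below_zero)
  have T_sum: "T (\<Sum>i<m. smult (c i) (monom 1 i)) = (\<Sum>i<m. smult (c i) (T (monom 1 i)))"
      and "(\<Sum>i<m. smult (c i) (monom 1 i)) \<in> polys_below n" if "m \<le> n" for c m
    using that
    by (induction m) (auto simp: T0 add smult polys_below_zero polys_below_add
        polys_below_smult monom_in_polys_below simp del: smult_monom)
  show "\<forall>v\<in>polys_below n. mat_op A v = T v"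
  proof
    fix v :: "'a poly" assume v: "v \<in> polys_below n"
    have expand: "T v = (\<Sum>j<n. smult (coeff v j) (T (monom 1 j)))"
      by (subst polys_below_expand[OF v]) (rule T_sum[OF order_refl])
    have entry: "A $$ (i, j) = coeff (T (monom 1 j)) i" if "i < n" "j < n" for i j
      using that by (simp add: A_def)
    show "mat_op A v = T v"
    proof (rule poly_eqI)
      fix i
      show "coeff (mat_op A v) i = coeff (T v) i"
      proof (cases "i < n")
        case True
        then show ?thesis
          by (simp add: coeff_mat_op[OF A] expand coeff_sum entry mult.commute)
      next
        case False
        then show ?thesis
          using closed[OF v] by (simp add: coeff_mat_op[OF A] polys_below_def)
      qed
    qed
  qed
qed

text \<open>Cayley--Hamilton by the module argument. With \<open>X\<close> acting as \<open>A\<close>, the columns of \<open>X - A\<close> are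
relations between the unit vectors. Multiplying these relations by the adjugate of \<open>X - A\<close> turns
its determinant, the characteristic polynomial, into an annihilator of each unit vector.\<close>

lemma cayley_hamilton_op:
  fixes A :: "'a :: field mat"
  assumes A: "A \<in> carrier_mat n n" and v: "v \<in> polys_below n"
  shows "poly_act (mat_op A) (char_poly A) v = 0"
proof -
  interpret linear_op "mat_op A" by (rule linear_mat_op)
  let ?T = "mat_op A" and ?M = "char_poly_matrix A" and ?D = "adj_mat (char_poly_matrix A)"
  let ?e = "\<lambda>i. monom (1 :: 'a) i"
  have M: "?M \<in> carrier_mat n n" using A by simp
  note D = adj_mat(1)[OF M]
  have rel: "(\<Sum>i<n. poly_act ?T (?M $$ (i, j)) (?e i)) = 0" if j: "j < n" for j
  proof -
    have "poly_act ?T (?M $$ (i, j)) (?e i) =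
        (if i = j then ?T (?e j) else 0) - smult (A $$ (i, j)) (?e i)" if i: "i < n" for i
      using A i j by (simp add: char_poly_matrix_def)
    then have "(\<Sum>i<n. poly_act ?T (?M $$ (i, j)) (?e i)) =
        ?T (?e j) - (\<Sum>i<n. smult (A $$ (i, j)) (?e i))"
      using j by (simp add: sum_subtractf del: smult_monom)
    also have "(\<Sum>i<n. smult (A $$ (i, j)) (?e i)) = ?T (?e j)"
      by (auto simp: poly_eq_iff coeff_sum mat_op_monom[OF A j] if_distrib cong: if_cong)
    finally show ?thesis by simp
  qed
  have basis: "poly_act ?T (char_poly A) (?e k) = 0" if k: "k < n" for k
  proof -
    have entry: "(?M * ?D) $$ (i, k) = (\<Sum>j<n. ?D $$ (j, k) * ?M $$ (i, j))" if "i < n" for i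
      using M D that k by (simp add: scalar_prod_def atLeast0LessThan mult.commute)
    have "poly_act ?T (char_poly A) (?e k) =
        (\<Sum>i<n. poly_act ?T (if i = k then char_poly A else 0) (?e i))"
      using k by (simp add: if_distrib if_distribR cong: if_cong)
    also have "\<dots> = (\<Sum>i<n. poly_act ?T ((?M * ?D) $$ (i, k)) (?e i))"
      using k by (intro sum.cong) (auto simp: adj_mat(2)[OF M] char_poly_def)
    also have "\<dots> = (\<Sum>i<n. \<Sum>j<n. poly_act ?T (?D $$ (j, k)) (poly_act ?T (?M $$ (i, j)) (?e i)))"
      by (intro sum.cong refl) (simp only: entry lessThan_iff poly_act_sum poly_act_mult)
    also have "\<dots> = (\<Sum>j<n. poly_act ?T (?D $$ (j, k)) (\<Sum>i<n. poly_act ?T (?M $$ (i, j)) (?e i)))"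
      by (subst sum.swap) (simp only: poly_act_vec_sum)
    also have "\<dots> = 0"
      by (intro sum.neutral) (auto simp: rel)
    finally show ?thesis .
  qed
  show ?thesis
    by (subst polys_below_expand[OF v])
      (simp add: poly_act_vec_sum poly_act_vec_smult basis del: smult_monom)
qed

section \<open>Counting bases with first vector 1\<close>

text \<open>The linear combination of \<open>bs\<close> whose coefficients are those of \<open>q\<close>. For a basis \<open>bs\<close> this is
the coordinate isomorphism.\<close>

definition comb :: "'a :: field poly list \<Rightarrow> 'a poly \<Rightarrow> 'a poly" where
  "comb bs q = (\<Sum>i<length bs. smult (coeff q i) (bs ! i))"

definition indep :: "'a :: field poly list \<Rightarrow> bool" where
  "indep bs \<longleftrightarrow> (\<forall>q\<in>polys_below (length bs). comb bs q = 0 \<longrightarrow> q = 0)"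

lemma comb_add: "comb bs (p + q) = comb bs p + comb bs q"
  by (simp add: comb_def smult_add_left sum.distrib)

lemma comb_diff: "comb bs (p - q) = comb bs p - comb bs q"
  by (simp add: comb_def smult_diff_left sum_subtractf)

lemma comb_smult: "comb bs (smult c q) = smult c (comb bs q)"
  by (simp add: comb_def smult_sum2)

lemma comb_monom: "i < length bs \<Longrightarrow> comb bs (monom 1 i) = bs ! i"
  by (simp add: comb_def if_distrib if_distribR cong: if_cong)

lemma comb_monom_beyond: "length bs \<le> i \<Longrightarrow> comb bs (monom c i) = 0"
  by (auto simp: comb_def)

lemma comb_snoc: "comb (bs @ [v]) q = comb bs q + smult (coeff q (length bs)) v"
  by (simp add: comb_def nth_append)

lemma comb_closed: "set bs \<subseteq> polys_below n \<Longrightarrow> comb bs q \<in> polys_below n"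
  by (auto simp: comb_def polys_below_def coeff_sum subset_iff intro!: sum.neutral)

lemma indep_inj: "indep bs \<Longrightarrow> inj_on (comb bs) (polys_below (length bs))"
  by (rule inj_onI) (metis comb_diff indep_def polys_below_diff right_minus_eq)

lemma indep_snoc:
  "indep (bs @ [v]) \<longleftrightarrow> indep bs \<and> v \<notin> comb bs ` polys_below (length bs)"
proof (intro iffI conjI notI)
  let ?k = "length bs"
  assume ind: "indep (bs @ [v])"
  show "indep bs"
    unfolding indep_def
  proof (intro ballI impI)
    fix q assume q: "q \<in> polys_below ?k" "comb bs q = 0"
    then have "q \<in> polys_below (Suc ?k)" "comb (bs @ [v]) q = 0"
      by (auto simp: polys_below_def comb_snoc)
    then show "q = 0" using ind by (simp add: indep_def)
  qed
  assume "v \<in> comb bs ` polys_below ?k"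
  then obtain q where q: "q \<in> polys_below ?k" "v = comb bs q" by auto
  let ?r = "q - monom 1 ?k"
  have "?r \<in> polys_below (Suc ?k)" "comb (bs @ [v]) ?r = 0"
    using q by (auto simp: polys_below_def comb_snoc comb_diff comb_monom_beyond)
  then have "?r = 0" using ind by (metis indep_def length_append_singleton)
  then have "coeff ?r ?k = 0" by simp
  then show False using q(1) by (simp add: polys_below_def)
next
  let ?k = "length bs"
  assume ind: "indep bs \<and> v \<notin> comb bs ` polys_below ?k"
  show "indep (bs @ [v])"
    unfolding indep_def
  proof (intro ballI impI)
    fix q assume q: "q \<in> polys_below (length (bs @ [v]))" "comb (bs @ [v]) q = 0"
    let ?r = "q - monom (coeff q ?k) ?k"
    have r: "?r \<in> polys_below ?k"
      unfolding polys_below_def mem_Collect_eq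
    proof (intro allI impI)
      fix i assume "?k \<le> i"
      then show "coeff ?r i = 0"
        using q(1) by (cases "i = ?k") (auto simp: polys_below_def)
    qed
    have c: "comb bs ?r + smult (coeff q ?k) v = 0"
      using q(2) by (simp add: comb_snoc comb_diff comb_monom_beyond)
    show "q = 0"
    proof (cases "coeff q ?k = 0")
      case True
      then show ?thesis using r c ind by (simp add: indep_def)
    next
      case False
      have "smult (coeff q ?k) v = - comb bs ?r"
        using c by (metis add.inverse_unique add.commute)
      then have "smult (inverse (coeff q ?k)) (smult (coeff q ?k) v) =
          smult (inverse (coeff q ?k)) (- comb bs ?r)" by simp
      then have "v = comb bs (smult (- inverse (coeff q ?k)) ?r)"
        using False unfolding comb_smult by simp
      moreover have "smult (- inverse (coeff q ?k)) ?r \<in> polys_below ?k"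
        by (rule polys_below_smult[OF r])
      ultimately show ?thesis using ind by blast
    qed
  qed
qed

text \<open>Fixing the first vector is what makes a basis a free parameter of a matrix of full order: it will
be the orbit of the vector 1.\<close>

definition indep_lists :: "nat \<Rightarrow> nat \<Rightarrow> bit poly list set" where
  "indep_lists n k = {bs. length bs = k \<and> set bs \<subseteq> polys_below n \<and> indep bs \<and> hd bs = 1}"

text \<open>The span of \<open>k\<close> independent vectors has \<open>2 ^ k\<close> elements, so an independent list of length
\<open>k\<close> extends in \<open>2 ^ n - 2 ^ k\<close> ways.\<close>

lemma card_indep_lists:
  assumes n: "n \<ge> 1"
  shows "finite (indep_lists n (Suc k)) \<and> card (indep_lists n (Suc k)) = (\<Prod>i=1..k. 2 ^ n - 2 ^ i)"
proof (induction k)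
  case 0
  have "indep_lists n (Suc 0) = {[1]}"
  proof (intro equalityI subsetI)
    fix bs :: "bit poly list" assume "bs \<in> {[1]}"
    moreover have "indep ([] @ [1])"
      unfolding indep_snoc by (simp add: indep_def polys_below_0 comb_def)
    ultimately show "bs \<in> indep_lists n (Suc 0)"
      using n by (auto simp: indep_lists_def polys_below_iff)
  qed (auto simp: indep_lists_def length_Suc_conv)
  then show ?case by simp
next
  case (Suc k)
  let ?span = "\<lambda>bs. comb bs ` polys_below (Suc k)"
  let ?f = "\<lambda>(bs, v). bs @ [v :: bit poly]"
  let ?P = "SIGMA bs:indep_lists n (Suc k). polys_below n - ?span bs"
  have eq: "indep_lists n (Suc (Suc k)) = ?f ` ?P"
  proof (intro equalityI subsetI)
    fix cs assume cs: "cs \<in> indep_lists n (Suc (Suc k))"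
    then have "cs \<noteq> []" by (auto simp: indep_lists_def)
    then obtain bs v where bs: "cs = bs @ [v]" by (metis rev_exhaust)
    moreover from this cs have "bs \<noteq> []" by (auto simp: indep_lists_def)
    ultimately have "(bs, v) \<in> ?P"
      using cs by (auto simp: indep_lists_def indep_snoc)
    then show "cs \<in> ?f ` ?P" using bs by force
  next
    fix cs assume "cs \<in> ?f ` ?P"
    then obtain bs v where "cs = bs @ [v]" "(bs, v) \<in> ?P" by auto
    moreover from this have "bs \<noteq> []" by (auto simp: indep_lists_def)
    ultimately show "cs \<in> indep_lists n (Suc (Suc k))"
      by (auto simp: indep_lists_def indep_snoc)
  qed
  have inj: "inj_on ?f ?P" by (auto simp: inj_on_def)
  have card_compl: "card (polys_below n - ?span bs) = 2 ^ n - 2 ^ Suc k"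
    if "bs \<in> indep_lists n (Suc k)" for bs
  proof -
    have "?span bs \<subseteq> polys_below n"
      using that comb_closed by (auto simp: indep_lists_def)
    moreover have "card (?span bs) = 2 ^ Suc k"
      using that indep_inj[of bs] by (auto simp: indep_lists_def card_image card_polys_below)
    ultimately show ?thesis
      by (simp add: card_Diff_subset finite_polys_below card_polys_below)
  qed
  have "card ?P = (\<Sum>bs\<in>indep_lists n (Suc k). 2 ^ n - 2 ^ Suc k)"
    using Suc.IH by (subst card_SigmaI) (auto simp: finite_polys_below card_compl intro!: sum.cong)
  also have "\<dots> = (\<Prod>i=1..Suc k. 2 ^ n - 2 ^ i)"
    using Suc.IH by simp
  finally have "card ?P = (\<Prod>i=1..Suc k. 2 ^ n - 2 ^ i)" .
  moreover have "finite ?P"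
    using Suc.IH by (auto simp: finite_polys_below)
  ultimately show ?case
    unfolding eq card_image[OF inj] by blast
qed

lemma comb_bij:
  assumes "bs \<in> indep_lists n n"
  shows "bij_betw (comb bs) (polys_below n) (polys_below n)"
proof -
  have inj: "inj_on (comb bs) (polys_below n)"
    using assms indep_inj by (auto simp: indep_lists_def)
  moreover have "comb bs ` polys_below n \<subseteq> polys_below n"
    using assms comb_closed by (auto simp: indep_lists_def)
  ultimately show ?thesis
    using endo_inj_surj[OF finite_polys_below] by (auto simp: bij_betw_def)
qed

section \<open>Matrices of order 2 ^ n - 1 as pairs of a basis and a primitive polynomial\<close>

definition krylov :: "nat \<Rightarrow> bit mat \<Rightarrow> bit poly list" where
  "krylov n A = map (\<lambda>i. (mat_op A ^^ i) 1) [0..<n]"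

text \<open>These are the generators of the Singer cycles. The power condition is the form in which the order
hypothesis enters the locale on ideals.\<close>

definition singer_mats :: "nat \<Rightarrow> bit mat set" where
  "singer_mats n = {A \<in> carrier_mat n n. \<forall>m. A ^\<^sub>m m = 1\<^sub>m n \<longleftrightarrow> (2 ^ n - 1) dvd m}"

lemma comb_krylov:
  assumes "q \<in> polys_below n"
  shows "comb (krylov n A) q = poly_act (mat_op A) q 1"
proof -
  interpret linear_op "mat_op A" by (rule linear_mat_op)
  show ?thesis using assms by (simp add: poly_act_below comb_def krylov_def)
qed

context
  fixes n :: nat
  assumes n: "n \<ge> 1"
begin

lemma one_in_polys_below: "1 \<in> polys_below n"
  using n by (auto simp: polys_below_iff)

lemma char_poly_degree:
  assumes "A \<in> carrier_mat n n"
  shows "degree (char_poly A) = n" "char_poly A \<noteq> 0"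
  using degree_monic_char_poly[OF assms] n by auto

lemma singer_ideal:
  assumes A: "A \<in> singer_mats n"
  shows "full_order_ideal n {q. \<forall>v\<in>polys_below n. poly_act (mat_op A) q v = 0}"
proof -
  interpret linear_op "mat_op A" by (rule linear_mat_op)
  have A': "A \<in> carrier_mat n n" "A ^\<^sub>m m = 1\<^sub>m n \<longleftrightarrow> (2 ^ n - 1) dvd m" for m
    using A by (auto simp only: singer_mats_def mem_Collect_eq)
  show ?thesis
  proof
    show "1 \<notin> {q. \<forall>v\<in>polys_below n. poly_act (mat_op A) q v = 0}"
      using one_in_polys_below by (auto intro!: bexI[of _ 1])
    show "monom 1 m - 1 \<in> {q. \<forall>v\<in>polys_below n. poly_act (mat_op A) q v = 0} \<longleftrightarrow>
        (2 ^ n - 1) dvd m" for m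
      unfolding A'(2)[symmetric] mat_pow_eq_one_iff[OF A'(1)]
      by (simp add: poly_act_diff poly_act_monom)
  qed (use n in \<open>auto simp: poly_act_add poly_act_mult\<close>)
qed

lemma singer_char_poly_primitive:
  assumes A: "A \<in> singer_mats n"
  shows "char_poly A \<in> primitive_polys n"
proof -
  interpret I: full_order_ideal n "{q. \<forall>v\<in>polys_below n. poly_act (mat_op A) q v = 0}"
    by (rule singer_ideal[OF A])
  have "A \<in> carrier_mat n n" using A by (simp add: singer_mats_def)
  then show ?thesis
    using cayley_hamilton_op char_poly_degree by (intro I.generator_primitive) auto
qed

text \<open>A nonzero polynomial \<open>q\<close> of degree less than \<open>n\<close> is not divisible by the characteristic
polynomial, so \<open>q(A)\<close> equals a power of \<open>A\<close>. As \<open>A\<close> is invertible, no such \<open>q\<close> can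
annihilate the vector 1.\<close>

lemma singer_krylov_indep:
  assumes A: "A \<in> singer_mats n"
  shows "krylov n A \<in> indep_lists n n"
proof -
  interpret linear_op "mat_op A" by (rule linear_mat_op)
  let ?T = "mat_op A"
  interpret I: full_order_ideal n "{q. \<forall>v\<in>polys_below n. poly_act (mat_op A) q v = 0}"
    by (rule singer_ideal[OF A])
  have car: "A \<in> carrier_mat n n" and ord: "A ^\<^sub>m m = 1\<^sub>m n \<longleftrightarrow> (2 ^ n - 1) dvd m" for m
    using A by (auto simp only: singer_mats_def mem_Collect_eq)
  have closed: "(?T ^^ i) 1 \<in> polys_below n" for i
    by (cases i) (auto simp: one_in_polys_below mat_op_closed[OF car])
  have orbit_nonzero: "(?T ^^ k) 1 \<noteq> 0" for k
  proof
    \<comment> \<open>Continue the orbit until the exponent is a multiple of the order of \<open>A\<close>.\<close>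
    assume "(?T ^^ k) 1 = 0"
    then have "(?T ^^ ((2 ^ n - 1) * k - k + k)) 1 = 0"
      by (simp only: funpow_add o_apply funpow_0)
    also have "(2 ^ n - 1) * k - k + k = (2 ^ n - 1) * k"
      using full_order_pos[OF n] by (cases "2 ^ n - 1 :: nat") simp_all
    also have "(?T ^^ ((2 ^ n - 1) * k)) 1 = 1"
      using ord[of "(2 ^ n - 1) * k"] mat_pow_eq_one_iff[OF car] one_in_polys_below
      by (meson dvd_triv_left)
    finally show False by simp
  qed
  have "indep (krylov n A)"
    unfolding indep_def
  proof (intro ballI impI)
    fix q assume "q \<in> polys_below (length (krylov n A))" "comb (krylov n A) q = 0"
    then have q: "q \<in> polys_below n" "poly_act ?T q 1 = 0"
      using comb_krylov by (auto simp: krylov_def)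
    show "q = 0"
    proof (rule ccontr)
      assume q0: "q \<noteq> 0"
      then have "degree q < n" using q(1) by (simp add: polys_below_iff)
      then have "\<not> char_poly A dvd q"
        using q0 char_poly_degree[OF car] by (auto dest: dvd_imp_degree_le)
      moreover have gen: "char_poly A \<in> {q. \<forall>v\<in>polys_below n. poly_act ?T q v = 0}"
          "char_poly A \<noteq> 0" "degree (char_poly A) \<le> n"
        using cayley_hamilton_op[OF car] char_poly_degree[OF car] by auto
      ultimately obtain k where "char_poly A dvd q - monom 1 k"
        using I.not_in_imp_power[OF gen, of q] I.in_iff_dvd[OF gen, of q] by auto
      then have "poly_act ?T (q - monom 1 k) 1 = 0"
        using poly_act_dvd cayley_hamilton_op[OF car one_in_polys_below] by blast
      then show False
        using q(2) orbit_nonzero by (simp add: poly_act_diff poly_act_monom)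
    qed
  qed
  moreover have "hd (krylov n A) = 1"
    using n by (simp add: krylov_def hd_map)
  ultimately show ?thesis
    using closed by (auto simp: indep_lists_def krylov_def)
qed

text \<open>In Krylov coordinates, \<open>A\<close> is multiplication by \<open>X\<close> modulo its characteristic polynomial. Hence
the pair of Krylov basis and characteristic polynomial determines \<open>A\<close>.\<close>

lemma mat_op_krylov:
  assumes A: "A \<in> carrier_mat n n" and q: "q \<in> polys_below n"
  shows "mat_op A (comb (krylov n A) q) = comb (krylov n A) (pCons 0 q mod char_poly A)"
proof -
  interpret linear_op "mat_op A" by (rule linear_mat_op)
  have "mat_op A (comb (krylov n A) q) = poly_act (mat_op A) (pCons 0 q) 1"
    using q by (simp add: comb_krylov)
  also have "\<dots> = poly_act (mat_op A) (pCons 0 q mod char_poly A) 1"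
    using poly_act_mod[OF cayley_hamilton_op[OF A one_in_polys_below]] by simp
  also have "pCons 0 q mod char_poly A \<in> polys_below n"
    using mod_in_polys_below[of "char_poly A"] char_poly_degree[OF A] by metis
  then have "poly_act (mat_op A) (pCons 0 q mod char_poly A) 1 =
      comb (krylov n A) (pCons 0 q mod char_poly A)"
    by (simp add: comb_krylov)
  finally show ?thesis .
qed

lemma inj_on_krylov_char_poly:
  "inj_on (\<lambda>A. (krylov n A, char_poly A)) (singer_mats n)"
proof (rule inj_onI)
  fix A B assume A: "A \<in> singer_mats n" and B: "B \<in> singer_mats n"
    and eq: "(krylov n A, char_poly A) = (krylov n B, char_poly B)"
  have car: "A \<in> carrier_mat n n" "B \<in> carrier_mat n n"
    using A B by (auto simp: singer_mats_def)
  show "A = B"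
  proof (rule mat_op_inject[OF car])
    fix v :: "bit poly" assume "v \<in> polys_below n"
    then obtain q where "q \<in> polys_below n" "v = comb (krylov n A) q"
      using bij_betw_imp_surj_on[OF comb_bij[OF singer_krylov_indep[OF A]]] by blast
    then show "mat_op A v = mat_op B v"
      using mat_op_krylov[OF car(1)] mat_op_krylov[OF car(2)] eq by simp
  qed
qed

text \<open>Transport multiplication by \<open>X\<close> on the residues modulo \<open>p\<close> along the coordinate isomorphism of
\<open>bs\<close>. Since \<open>X ^ i\<close> is its own residue for \<open>i < n\<close>, the orbit of the first basis vector runs
through \<open>bs\<close>; and powers of the matrix correspond to powers of \<open>X\<close> modulo \<open>p\<close>.\<close>

lemma singer_mat_exists:
  assumes bs: "bs \<in> indep_lists n n" and p: "p \<in> primitive_polys n"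
  shows "\<exists>A\<in>singer_mats n. krylov n A = bs \<and> char_poly A = p"
proof -
  have p0: "p \<noteq> 0" "degree p = n" using p n by (auto simp: primitive_polys_def)
  have len: "length bs = n" and hd: "hd bs = 1" using bs by (auto simp: indep_lists_def)
  have mod_below: "q mod p \<in> polys_below n" for q
    using mod_in_polys_below[OF p0(1), of q] p0(2) by simp
  have mod_id: "q mod p = q" if "q \<in> polys_below n" for q
    using that p0(2) by (auto simp: polys_below_iff mod_poly_less)
  note bij = comb_bij[OF bs]
  define coords where "coords = the_inv_into (polys_below n) (comb bs)"
  have coords_comb: "coords (comb bs q) = q" if "q \<in> polys_below n" for q
    unfolding coords_def using that bij by (intro the_inv_into_f_f) (auto simp: bij_betw_def)
  have surj: "\<exists>q\<in>polys_below n. v = comb bs q" if "v \<in> polys_below n" for v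
    using that bij_betw_imp_surj_on[OF bij] by blast
  have comb_below: "comb bs q \<in> polys_below n" for q
    using bs comb_closed by (auto simp: indep_lists_def)
  define T where "T v = comb bs (pCons 0 (coords v) mod p)" for v
  have "\<exists>A\<in>carrier_mat n n. \<forall>v\<in>polys_below n. mat_op A v = T v"
  proof (rule mat_op_exists)
    fix v w :: "bit poly" assume "v \<in> polys_below n" "w \<in> polys_below n"
    then obtain q r where q: "q \<in> polys_below n" "v = comb bs q"
      and r: "r \<in> polys_below n" "w = comb bs r" using surj by metis
    have "pCons 0 (q + r) mod p = pCons 0 q mod p + pCons 0 r mod p"
      by (simp flip: poly_mod_add_left)
    then show "T (v + w) = T v + T w"
      using q r polys_below_add[OF q(1) r(1)]
      by (simp add: T_def coords_comb flip: comb_add)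
  next
    fix c and v :: "bit poly" assume "v \<in> polys_below n"
    then obtain q where "q \<in> polys_below n" "v = comb bs q" using surj by metis
    moreover from this(1) have "smult c q \<in> polys_below n" by (rule polys_below_smult)
    moreover have "pCons 0 (smult c q) mod p = smult c (pCons 0 q mod p)"
      by (simp flip: mod_smult_left)
    ultimately show "T (smult c v) = smult c (T v)"
      by (simp add: T_def coords_comb flip: comb_smult)
  qed (simp add: T_def comb_below)
  then obtain A where A: "A \<in> carrier_mat n n"
    and AT: "\<And>v. v \<in> polys_below n \<Longrightarrow> mat_op A v = T v" by blast
  interpret linear_op "mat_op A" by (rule linear_mat_op)
  have act: "poly_act (mat_op A) r (comb bs q) = comb bs (r * q mod p)"
    if q: "q \<in> polys_below n" for q r
  proof (induction r)
    case 0
    then show ?case by (simp add: comb_def)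
  next
    case (pCons a r)
    have "mat_op A (comb bs (r * q mod p)) = comb bs (pCons 0 (r * q mod p) mod p)"
      by (simp add: AT comb_below T_def coords_comb mod_below)
    also have "pCons 0 (r * q mod p) mod p = pCons 0 (r * q) mod p"
      using mod_mult_right_eq[of "[:0, 1:]" "r * q" p] by simp
    finally show ?case
      using q by (simp add: pCons.IH poly_mod_add_left comb_add comb_smult mod_smult_left mod_id)
  qed
  have pow: "(mat_op A ^^ k) (comb bs q) = comb bs (monom 1 k * q mod p)"
    if "q \<in> polys_below n" for k q
    using act[OF that, of "monom 1 k"] by (simp add: poly_act_monom)
  have comb_1: "comb bs 1 = 1"
    using comb_monom[of 0 bs] hd_conv_nth[of bs] len hd n
    by (cases "bs = []") (simp_all flip: one_pCons)
  have kry: "krylov n A = bs"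
  proof (rule nth_equalityI)
    fix i assume "i < length (krylov n A)"
    then have i: "i < n" by (simp add: krylov_def)
    have "(mat_op A ^^ i) 1 = comb bs (monom 1 i)"
      using pow[OF one_in_polys_below, of i] mod_id[OF monom_in_polys_below[OF i]]
      by (simp add: comb_1)
    then show "krylov n A ! i = bs ! i"
      using i len by (simp add: krylov_def comb_monom)
  qed (simp add: krylov_def len)
  have comb_eq: "comb bs (r mod p) = comb bs q \<longleftrightarrow> r mod p = q mod p"
    if "q \<in> polys_below n" for q r
    using coords_comb[OF mod_below[of r]] coords_comb[OF that] mod_id[OF that] by metis
  have "A ^\<^sub>m m = 1\<^sub>m n \<longleftrightarrow> p dvd monom 1 m - 1" for m
  proof -
    have "A ^\<^sub>m m = 1\<^sub>m n \<longleftrightarrow> (\<forall>v\<in>comb bs ` polys_below n. (mat_op A ^^ m) v = v)"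
      by (simp only: mat_pow_eq_one_iff[OF A] bij_betw_imp_surj_on[OF bij])
    also have "\<dots> \<longleftrightarrow> (\<forall>q\<in>polys_below n. monom 1 m * q mod p = q mod p)"
      by (simp add: pow comb_eq)
    also have "\<dots> \<longleftrightarrow> p dvd monom 1 m - 1"
    proof
      assume "\<forall>q\<in>polys_below n. monom 1 m * q mod p = q mod p"
      then show "p dvd monom 1 m - 1"
        using one_in_polys_below by (auto simp: mod_eq_dvd_iff dest!: bspec[of _ _ 1])
    next
      assume "p dvd monom 1 m - 1"
      then have "p dvd (monom 1 m - 1) * q" for q by (rule dvd_mult2)
      then show "\<forall>q\<in>polys_below n. monom 1 m * q mod p = q mod p"
        by (simp add: mod_eq_dvd_iff left_diff_distrib)
    qed
    finally show ?thesis .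
  qed
  then have singer: "A \<in> singer_mats n"
    using A p by (simp add: singer_mats_def primitive_polys_def)
  have "comb bs (char_poly A mod p) = 0"
    using act[OF one_in_polys_below, of "char_poly A"]
      cayley_hamilton_op[OF A one_in_polys_below] comb_1 by simp
  then have "char_poly A mod p = 0"
    using coords_comb[OF mod_below] coords_comb[OF polys_below_zero] by (metis comb_diff diff_self)
  then have "p = char_poly A"
    using char_poly_degree[OF A] p0 by (intro dvd_same_degree_eq) auto
  then show ?thesis using singer kry by blast
qed

lemma card_singer_mats:
  "n * card (singer_mats n) = (\<Prod>i=1..n - 1. 2 ^ n - 2 ^ i) * totient (2 ^ n - 1)"
proof -
  have "bij_betw (\<lambda>A. (krylov n A, char_poly A)) (singer_mats n)
      (indep_lists n n \<times> primitive_polys n)"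
    unfolding bij_betw_def
  proof
    show "(\<lambda>A. (krylov n A, char_poly A)) ` singer_mats n = indep_lists n n \<times> primitive_polys n"
      using singer_krylov_indep singer_char_poly_primitive singer_mat_exists
      by (auto simp: image_iff) metis
  qed (rule inj_on_krylov_char_poly)
  then have "card (singer_mats n) = card (indep_lists n n) * card (primitive_polys n)"
    by (simp add: bij_betw_same_card card_cartesian_product)
  also have "card (indep_lists n n) = (\<Prod>i=1..n - 1. 2 ^ n - 2 ^ i)"
    using card_indep_lists[OF n, of "n - 1"] n by simp
  finally show ?thesis
    using card_primitive_polys[OF n] by (simp add: ac_simps)
qed

lemma full_order_eq_singer_mats:
  "{A \<in> carrier (GL2 n). group.ord (GL2 n) A = 2 ^ n - 1} = singer_mats n"
proof -
  interpret G: Group.group "GL2 n" by (rule group_GL2)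
  have one: "\<one>\<^bsub>GL2 n\<^esub> = 1\<^sub>m n" and mult: "A \<otimes>\<^bsub>GL2 n\<^esub> B = A * B" for A B
    by (simp_all add: GL2_def units_of_def ring_mat_def)
  have pow: "A [^]\<^bsub>GL2 n\<^esub> k = A ^\<^sub>m k" if "A \<in> carrier_mat n n" for A and k :: nat
    using that by (induction k) (simp_all add: one mult)
  have invertible: "A \<in> carrier (GL2 n)" if A: "A \<in> singer_mats n" for A
  proof -
    obtain k where k: "2 ^ n - 1 = Suc k"
      using full_order_pos[OF n] gr0_implies_Suc by blast
    have car: "A \<in> carrier_mat n n" and "A ^\<^sub>m (2 ^ n - 1) = 1\<^sub>m n"
      using A by (simp_all only: singer_mats_def mem_Collect_eq dvd_refl)
    then have left: "A ^\<^sub>m k * A = 1\<^sub>m n"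
      unfolding k by simp
    have right: "A * A ^\<^sub>m k = 1\<^sub>m n"
      by (rule mat_mult_left_right_inverse[OF pow_carrier_mat[OF car] car left])
    show ?thesis
      using car left right by (auto simp: GL2_carrier invertible_mat_def inverts_mat_def)
  qed
  have "group.ord (GL2 n) A = 2 ^ n - 1 \<longleftrightarrow> (\<forall>m. A ^\<^sub>m m = 1\<^sub>m n \<longleftrightarrow> (2 ^ n - 1) dvd m)"
    if A: "A \<in> carrier (GL2 n)" for A
  proof -
    have "A \<in> carrier_mat n n" using A by (simp add: GL2_carrier)
    then have "A ^\<^sub>m m = 1\<^sub>m n \<longleftrightarrow> G.ord A dvd m" for m
      using G.pow_eq_id[OF A, of m] by (simp add: pow one)
    then show ?thesis by (metis dvd_antisym dvd_refl)
  qed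
  then show ?thesis
    using invertible by (auto simp: singer_mats_def GL2_carrier)
qed

end

theorem mainTheorem1:
  fixes n :: nat
  assumes "n \<ge> 1"
  shows "real (card {A \<in> carrier (GL2 n). group.ord (GL2 n) A = 2 ^ n - 1}) =
    (\<Prod>i = 1..n - 1. (2::real) ^ n - 2 ^ i) * (real (totient (2 ^ n - 1)) / real n)"
proof -
  have "real (\<Prod>i = 1..n - 1. 2 ^ n - 2 ^ i) = (\<Prod>i = 1..n - 1. (2::real) ^ n - 2 ^ i)"
    unfolding of_nat_prod
  proof (intro prod.cong refl)
    fix i assume "i \<in> {1..n - 1}"
    then have "(2 :: nat) ^ i \<le> 2 ^ n" by (intro power_increasing) auto
    then show "real (2 ^ n - 2 ^ i) = 2 ^ n - 2 ^ i" by (simp add: of_nat_diff)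
  qed
  then have "real n * real (card (singer_mats n)) =
      (\<Prod>i = 1..n - 1. (2::real) ^ n - 2 ^ i) * real (totient (2 ^ n - 1))"
    using arg_cong[OF card_singer_mats[OF assms], of real] by (simp only: of_nat_mult)
  then show ?thesis
    using assms unfolding full_order_eq_singer_mats[OF assms] by (simp add: field_simps)
qed

end
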